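(* For every integer $k\ge 0$, the varied Ward-Lah numbers $V(n,k)$ satisfy the following identity of formal power series in $x$: $$\sum_{n=k}^{\infty}V(n,k)\,\frac{x^n}{(2n)!}=\left(\frac{x}{1-x}\right)^k.$$
   Context: Partition transformation: for integers $n,k\ge 0$ and a sequence $a_1,a_2,\dots$, $$P_n^k(a_1,a_2,\dots)=\sum_{q}(-1)^{q_0}\prod_{j=0}^{\ell(q)-1}\binom{q_j}{q_{j+1}}a_{j+1}^{q_j},$$ where the sum is over integer partitions $q=(q_0\ge q_1\ge\dots)$ of $n=q_0+q_1+\cdots$ with $q_0=k$; $\ell(q)$ is the length of $q$ (number of positive parts), so $q_{\ell(q)-1}>0$ and $q_{\ell(q)}=0$. Varied Ward-Lah numbers: for integers $n\ge k\ge 0$, $V(n,k)=(-1)^k (2n)!\,P_n^k(1,1,\dots)$ (all $a_i=1$), with $V(0,0)=1$, $V(n,0)=0$ for $n\ge 1$, $V(0,k)=0$ for $k\ge 1$, and $V(n,k)=0$ for $k>n$. *)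

theory Defs
  imports "HOL-Computational_Algebra.Formal_Power_Series"
begin

text \<open>An integer partition is a weakly decreasing, finitely supported sequence
  \<open>q 0 \<ge> q 1 \<ge> \<dots>\<close> of natural numbers; the empty partition is the zero sequence.\<close>

definition is_partition :: "(nat \<Rightarrow> nat) \<Rightarrow> bool"
  where "is_partition q \<longleftrightarrow> antimono q \<and> finite {j. q j > 0}"

definition part_sum :: "(nat \<Rightarrow> nat) \<Rightarrow> nat"
  where "part_sum q = (\<Sum>j | q j > 0. q j)"

definition part_length :: "(nat \<Rightarrow> nat) \<Rightarrow> nat"
  where "part_length q = card {j. q j > 0}"

definition partitions :: "nat \<Rightarrow> nat \<Rightarrow> (nat \<Rightarrow> nat) set"
  where "partitions n k = {q. is_partition q \<and> part_sum q = n \<and> q 0 = k}"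

text \<open>The sequence \<open>a\<close> is indexed from 1; the value \<open>a 0\<close> is never used.\<close>

definition partition_transform :: "nat \<Rightarrow> nat \<Rightarrow> (nat \<Rightarrow> 'a) \<Rightarrow> 'a :: comm_ring_1"
  where "partition_transform n k a =
    (\<Sum>q\<in>partitions n k. (-1) ^ q 0 *
      (\<Prod>j<part_length q. of_nat (q j choose q (j + 1)) * a (j + 1) ^ q j))"

definition varied_ward_lah :: "nat \<Rightarrow> nat \<Rightarrow> int"
  where "varied_ward_lah n k =
    (if k \<le> n then (-1) ^ k * fact (2 * n) * partition_transform n k (\<lambda>_. 1) else 0)"

lemma partition_less:
  assumes "q \<in> partitions n k" "q j > 0"
  shows "j < n" "q j \<le> n"
proof -
  have fin: "finite {j. q j > 0}" and mono: "antimono q"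
    and n: "(\<Sum>j | q j > 0. q j) = n"
    using assms(1) by (auto simp: partitions_def is_partition_def part_sum_def)
  have sub: "{..j} \<subseteq> {j. q j > 0}"
  proof
    fix i assume "i \<in> {..j}"
    then have "q j \<le> q i" using mono by (auto simp: antimono_def)
    then show "i \<in> {j. q j > 0}" using assms(2) by simp
  qed
  have "j + 1 = (\<Sum>i\<le>j. 1)" by simp
  also have "\<dots> \<le> (\<Sum>i\<le>j. q i)" using sub by (intro sum_mono) (auto simp: Suc_le_eq)
  also have "\<dots> \<le> n" unfolding n[symmetric] by (rule sum_mono2[OF fin sub]) simp
  finally show "j < n" by simp
  show "q j \<le> n" unfolding n[symmetric] by (rule member_le_sum) (use fin assms(2) in auto)
qed

lemma finite_partitions: "finite (partitions n k)"
proof (rule finite_subset)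
  show "partitions n k \<subseteq> {q. \<forall>j. (j \<in> {..<n} \<longrightarrow> q j \<in> {..n}) \<and> (j \<notin> {..<n} \<longrightarrow> q j = 0)}"
  proof (intro subsetI CollectI allI conjI impI)
    fix q j assume q: "q \<in> partitions n k"
    show "q j \<in> {..n}" using partition_less(2)[OF q, of j] by (cases "q j = 0") auto
    show "q j = 0" if "j \<notin> {..<n}" using partition_less(1)[OF q, of j] that by (cases "q j = 0") auto
  qed
  show "finite {q. \<forall>j. (j \<in> {..<n} \<longrightarrow> q j \<in> {..n}) \<and> (j \<notin> {..<n} \<longrightarrow> q j = (0::nat))}"
    by (rule finite_set_of_finite_funs) auto
qed

lemma partitions_0_right: "partitions n 0 = (if n = 0 then {\<lambda>_. 0} else {})"
proof -
  have "q = (\<lambda>_. 0)" if "q \<in> partitions n 0" for q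
  proof
    fix j
    have "antimono q" "q 0 = 0"
      using that by (auto simp: partitions_def is_partition_def)
    then show "q j = 0" using antimonoD[of q 0 j] by simp
  qed
  then have "partitions n 0 \<subseteq> {\<lambda>_. 0}" by (intro subsetI) (simp only: singleton_iff)
  moreover have "(\<lambda>_. 0) \<in> partitions n 0 \<longleftrightarrow> n = 0"
    by (auto simp: partitions_def is_partition_def part_sum_def antimono_def)
  ultimately show ?thesis
    by (auto dest!: subset_singletonD simp del: singleton_conv2)
qed

text \<open>The boundary values prescribed for the varied Ward-Lah numbers are consequences
  of the definition.\<close>

lemma varied_ward_lah_boundary:
  "varied_ward_lah 0 0 = 1"
  "n \<ge> 1 \<Longrightarrow> varied_ward_lah n 0 = 0"
  "k \<ge> 1 \<Longrightarrow> varied_ward_lah 0 k = 0"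
  "k > n \<Longrightarrow> varied_ward_lah n k = 0"
  by (simp_all add: varied_ward_lah_def partition_transform_def partitions_0_right part_length_def)

end

(* Removing the first part k of a partition of n + k leaves a partition of n whose first part m is at
   most k, so (-1)^k P_(n+k)^k(1,1,...) is the sum over m of binom(k,m) (-1)^m P_n^m(1,1,...).
   The coefficients of g^k for g = x/(1-x) obey the same recurrence, because g = x (1 + g). *)

theory Submission
  imports Defs
begin

unbundle fps_syntax

lemma antimono_case_nat_iff:
  "antimono (case_nat k p) \<longleftrightarrow> p 0 \<le> k \<and> antimono p" for p :: "nat \<Rightarrow> 'a::order"
  unfolding antimono_iff_le_Suc by (auto split: nat.split)

text \<open>\<open>case_nat k p\<close> prepends the part \<open>k\<close> to \<open>p\<close>,
  shifting every index by one. Positivity of \<open>k\<close> puts the new index 0 into the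
  support.\<close>

lemma support_case_nat:
  fixes k :: nat
  assumes "k > 0"
  shows "{j. case_nat k p j > 0} = insert 0 (Suc ` {j. p j > 0})"
proof (rule set_eqI)
  show "j \<in> {j. case_nat k p j > 0} \<longleftrightarrow> j \<in> insert 0 (Suc ` {j. p j > 0})" for j
    using assms by (cases j) auto
qed

lemma is_partition_case_nat:
  assumes "k > 0"
  shows "is_partition (case_nat k p) \<longleftrightarrow> p 0 \<le> k \<and> is_partition p"
  unfolding is_partition_def antimono_case_nat_iff support_case_nat[OF assms]
  by (simp add: finite_image_iff)

lemma part_sum_case_nat:
  assumes "k > 0" "is_partition p"
  shows "part_sum (case_nat k p) = k + part_sum p"
proof -
  have "finite {j. p j > 0}" using assms(2) by (simp add: is_partition_def)
  then show ?thesis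
    unfolding part_sum_def support_case_nat[OF assms(1)]
    by (subst sum.insert) (auto simp: sum.reindex)
qed

lemma part_length_case_nat:
  assumes "k > 0" "is_partition p"
  shows "part_length (case_nat k p) = Suc (part_length p)"
proof -
  have "finite {j. p j > 0}" using assms(2) by (simp add: is_partition_def)
  then show ?thesis
    unfolding part_length_def support_case_nat[OF assms(1)]
    by (subst card_insert_disjoint) (auto simp: card_image)
qed

text \<open>Prepending \<open>k\<close> is inverted by dropping the first part,
  \<open>q \<circ> Suc\<close>. Monotonicity at index 0 is exactly the bound
  \<open>m \<le> k\<close> on the next part.\<close>

lemma partitions_add:
  assumes "k > 0"
  shows "partitions (n + k) k = case_nat k ` (\<Union>m\<le>k. partitions n m)"
proof (intro equalityI subsetI)
  fix q assume q: "q \<in> partitions (n + k) k"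
  define p where "p = q \<circ> Suc"
  have qp: "q = case_nat k p"
    using q by (auto simp: p_def partitions_def split: nat.split)
  have "p \<in> (\<Union>m\<le>k. partitions n m)"
    using q part_sum_case_nat[OF assms, of p]
    by (auto simp: qp partitions_def is_partition_case_nat[OF assms])
  then show "q \<in> case_nat k ` (\<Union>m\<le>k. partitions n m)"
    using qp by blast
qed (auto simp: partitions_def is_partition_case_nat[OF assms] part_sum_case_nat[OF assms])

lemma inj_case_nat: "inj (case_nat k)"
proof (rule injI, rule ext)
  fix p q :: "nat \<Rightarrow> 'a" and j assume "case_nat k p = case_nat k q"
  from fun_cong[OF this, of "Suc j"] show "p j = q j" by simp
qed

text \<open>The new part contributes the factor at j = 0, and all later factors read the sequence
  one place further on. Hence the form with a shifted sequence; a constant sequence is fixed by the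
  shift, which turns this into a recurrence.\<close>

lemma partition_transform_add:
  fixes a :: "nat \<Rightarrow> 'a :: comm_ring_1"
  assumes "k > 0"
  shows "partition_transform (n + k) k a =
    (- a 1) ^ k * (\<Sum>m\<le>k. (-1) ^ m * of_nat (k choose m) * partition_transform n m (\<lambda>j. a (Suc j)))"
proof -
  define F where "F a q = (-1) ^ q 0 *
      (\<Prod>j<part_length q. of_nat (q j choose q (j + 1)) * a (j + 1) ^ q j)"
    for a :: "nat \<Rightarrow> 'a" and q
  have F: "F a (case_nat k p) =
      (- a 1) ^ k * ((-1) ^ m * of_nat (k choose m) * F (\<lambda>j. a (Suc j)) p)"
    if "p \<in> partitions n m" for p m
  proof -
    have p: "is_partition p" "p 0 = m" using that by (auto simp: partitions_def)
    \<comment> \<open>The summand of \<open>case_nat k p\<close> has only the sign of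
      \<open>k\<close>, so the sign (-1)^m inside \<open>F\<close> for \<open>p\<close> must be
      cancelled by a second one.\<close>
    have "(-1) ^ m * (-1) ^ m = (1 :: 'a)"
      by (simp flip: power_mult_distrib)
    then show ?thesis
      unfolding F_def part_length_case_nat[OF assms p(1)] prod.lessThan_Suc_shift power_minus[of "a 1"]
      by (simp add: p mult_ac)
  qed
  have "partition_transform (n + k) k a = (\<Sum>p\<in>(\<Union>m\<le>k. partitions n m). F a (case_nat k p))"
    unfolding partition_transform_def partitions_add[OF assms] F_def
    by (subst sum.reindex) (auto intro: inj_on_subset[OF inj_case_nat])
  also have "\<dots> = (\<Sum>m\<le>k. \<Sum>p\<in>partitions n m. F a (case_nat k p))"
    \<comment> \<open>The union is disjoint because \<open>m\<close> is recovered from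
      \<open>p\<close> as \<open>p 0\<close>.\<close>
    by (rule sum.UNION_disjoint) (simp_all add: finite_partitions, auto simp: partitions_def)
  also have "\<dots> = (\<Sum>m\<le>k. \<Sum>p\<in>partitions n m.
      (- a 1) ^ k * ((-1) ^ m * of_nat (k choose m) * F (\<lambda>j. a (Suc j)) p))"
    by (intro sum.cong refl) (rule F)
  finally show ?thesis
    unfolding partition_transform_def[of n] sum_distrib_left F_def by simp
qed

lemma partitions_eq_empty: "n < k \<Longrightarrow> partitions n k = {}"
  using partition_less(2)[of _ n k 0] by (fastforce simp: partitions_def)

text \<open>Strong induction on \<open>n\<close> for all \<open>k\<close> at once: the recurrence
  passes from (n, k) to (n - k, m) for every \<open>m \<le> k\<close>, and n - k < n when 0 < k
  \<le> n.\<close>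

lemma partition_transform_one:
  "(-1) ^ k * partition_transform n k (\<lambda>_. 1) = (fps_X / (1 - fps_X) :: 'a::field fps) ^ k $ n"
proof (induction n arbitrary: k rule: less_induct)
  case (less n)
  define g :: "'a fps" where "g = fps_X / (1 - fps_X)"
  have unit: "(1 - fps_X :: 'a fps) $ 0 \<noteq> 0" by simp
  have g: "g = fps_X * (1 + g)"
  proof -
    have "g * (1 - fps_X) = fps_X"
      using unit by (simp add: g_def fps_divide_unit mult.assoc inverse_mult_eq_1)
    then show ?thesis by (simp add: algebra_simps)
  qed
  \<comment> \<open>The factor \<open>fps_X ^ k\<close> kills the coefficients below
    \<open>k\<close> and otherwise reduces coefficient n to coefficient n - k of
    \<open>(1 + g) ^ k\<close>, where the binomial theorem applies.\<close>
  have gk: "g ^ k = fps_X ^ k * (1 + g) ^ k"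
    by (subst g) (rule power_mult_distrib)
  consider "k = 0" | "n < k" | "0 < k" "k \<le> n" by linarith
  then have "(-1) ^ k * partition_transform n k (\<lambda>_. 1) = g ^ k $ n"
  proof cases
    case 1
    then show ?thesis
      by (simp add: partition_transform_def partitions_0_right part_length_def)
  next
    case 2
    then show ?thesis
      by (simp add: gk fps_X_power_mult_nth partition_transform_def partitions_eq_empty)
  next
    case 3
    have "g ^ k $ n = (\<Sum>m\<le>k. of_nat (k choose m) * g ^ m) $ (n - k)"
      using 3 by (simp add: gk fps_X_power_mult_nth binomial_ring[of g 1, simplified] add.commute[of 1])
    also have "\<dots> = (\<Sum>m\<le>k. of_nat (k choose m) * (g ^ m $ (n - k)))"
      by (simp add: fps_sum_nth fps_of_nat[symmetric])
    also have "\<dots> = (\<Sum>m\<le>k. (-1) ^ m * of_nat (k choose m) * partition_transform (n - k) m (\<lambda>_. 1))"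
      using 3 by (intro sum.cong refl) (simp add: less.IH[symmetric] g_def mult_ac)
    \<comment> \<open>For the constant sequence 1 the recurrence has the prefactor (-1)^k, which the
      outer sign cancels.\<close>
    also have "\<dots> = (-1) ^ k * partition_transform n k (\<lambda>_. 1)"
      using partition_transform_add[OF 3(1), of "n - k" "\<lambda>_. 1 :: 'a"] 3(2)
      by (simp flip: mult.assoc power_mult_distrib)
    finally show ?thesis by simp
  qed
  then show ?case by (simp add: g_def)
qed

text \<open>Moves the integer-valued transform into the field where the power series live.\<close>

lemma of_int_partition_transform:
  "of_int (partition_transform n k a) = partition_transform n k (\<lambda>j. of_int (a j))"
  by (simp add: partition_transform_def)

theorem theorem4p9:
  fixes k :: nat
  shows "Abs_fps (\<lambda>n. if k \<le> n then of_int (varied_ward_lah n k) / fact (2 * n) else 0)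
       = (fps_X / (1 - fps_X) :: rat fps) ^ k"
proof (rule fps_ext)
  fix n
  \<comment> \<open>The factorials cancel for \<open>k \<le> n\<close>; otherwise the right side is
    an empty sum, in agreement with the default 0.\<close>
  have "(if k \<le> n then of_int (varied_ward_lah n k) / fact (2 * n) else 0 :: rat) =
      (-1) ^ k * partition_transform n k (\<lambda>_. 1)"
    by (auto simp: varied_ward_lah_def of_int_partition_transform partition_transform_def
        partitions_eq_empty)
  then show "Abs_fps (\<lambda>n. if k \<le> n then of_int (varied_ward_lah n k) / fact (2 * n) else 0) $ n
      = (fps_X / (1 - fps_X) :: rat fps) ^ k $ n"
    by (simp add: partition_transform_one)
qed

end
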